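(* For every natural number $m \geq 1$, the graph $S^m_3$ (the cycle $C_3$ with a path of $m$ new vertices attached at each of its three vertices) satisfies $\gamma_b(S^m_3) = m+1$.
   Context: For integers $k \geq 3$ and $n \geq 1$, the $k$-sunlet graph of degree $n$, denoted $S^n_k$, is obtained from the cycle $C_k$ (whose vertices are called base vertices) by attaching to each base vertex $b$ a path of $n$ new vertices $b = u_0, u_1, \dots, u_n$ (edges $u_0u_1, u_1u_2,\dots,u_{n-1}u_n$), distinct for different base vertices; so the farthest vertex $u_n$ of each branch is at distance $n$ from its base vertex. For a finite graph $G$ with shortest-path distance $d$, a dominating broadcast function is a function $f: V(G) \to \{0,1,2,\dots\}$ such that every vertex $u$ of $G$ satisfies $d(u,v) \leq f(v)$ for at least one vertex $v$ with $f(v) \geq 1$. The cost of $f$ is $\sum_{v \in V(G)} f(v)$, and $\gamma_b(G)$ is the minimum cost of a dominating broadcast function of $G$. *)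

theory Defs
  imports
    "Graph_Theory.Pair_Digraph"
    "Graph_Theory.Shortest_Path"
begin

text \<open>
  As usual in \<^theory>\<open>Graph_Theory.Digraph\<close>, undirected graphs are symmetric digraphs
  (locale \<^locale>\<open>graph\<close>).  Vertex \<open>(i, j)\<close> is the vertex at distance \<open>j\<close> from the base
  vertex \<open>(i, 0)\<close> on the branch attached there.
\<close>

definition sunlet :: "nat \<Rightarrow> nat \<Rightarrow> (nat \<times> nat) pair_pre_digraph" where
  "sunlet k n =
     (let E = {((i, 0), ((i + 1) mod k, 0)) | i. i < k} \<union>
              {((i, j), (i, j + 1)) | i j. i < k \<and> j < n}
      in \<lparr>pverts = {..<k} \<times> {..n}, parcs = E \<union> E\<inverse>\<rparr>)"

text \<open>
  The library constant \<open>wf_digraph.\<mu>\<close> (weighted distance) is specified only for well-formed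
  digraphs; unit weights turn it into the number of edges of a shortest walk, and it is
  infinite if there is no walk.
\<close>

definition graph_dist :: "('a, 'b) pre_digraph \<Rightarrow> 'a \<Rightarrow> 'a \<Rightarrow> ereal" where
  "graph_dist G u v = wf_digraph.\<mu> G (\<lambda>_. 1) u v"

definition dominating_broadcast :: "('a, 'b) pre_digraph \<Rightarrow> ('a \<Rightarrow> nat) \<Rightarrow> bool" where
  "dominating_broadcast G f \<longleftrightarrow>
     (\<forall>u\<in>verts G. \<exists>v\<in>verts G. f v \<ge> 1 \<and> graph_dist G u v \<le> ereal (real (f v)))"

text \<open>
  Meant for finite graphs: over an infinite vertex set the sum is \<open>0\<close>.
\<close>

definition broadcast_cost :: "('a, 'b) pre_digraph \<Rightarrow> ('a \<Rightarrow> nat) \<Rightarrow> nat" where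
  "broadcast_cost G f = (\<Sum>v\<in>verts G. f v)"

definition broadcast_number :: "('a, 'b) pre_digraph \<Rightarrow> nat" where
  "broadcast_number G = (LEAST c. \<exists>f. dominating_broadcast G f \<and> broadcast_cost G f = c)"

lemma pair_graph_sunlet:
  assumes "k \<ge> 3"
  shows "pair_graph (sunlet k n)"
proof -
  have base: "{((i, 0::nat), ((i + 1) mod k, 0::nat)) | i. i < k}
      = (\<lambda>i. ((i, 0), ((i + 1) mod k, 0))) ` {..<k}"
    by auto
  have branch: "{((i, j), (i, j + 1)) | i j. i < k \<and> j < n}
      = (\<lambda>(i, j). ((i, j), (i, j + 1))) ` ({..<k} \<times> {..<n})"
    by auto
  have no_loop: "(i + 1) mod k \<noteq> i" if "i < k" for i
    using that assms by (cases "i + 1 = k") auto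
  show ?thesis
  proof unfold_locales
    show "finite (parcs (sunlet k n))"
      unfolding sunlet_def Let_def base branch by simp
    show "symmetric (with_proj (sunlet k n))"
      unfolding symmetric_def by (auto simp: sunlet_def Let_def intro!: symI)
  qed (use assms no_loop in \<open>fastforce simp: sunlet_def Let_def\<close>)+
qed

lemma graph_sunlet:
  assumes "k \<ge> 3"
  shows "graph (with_proj (sunlet k n))"
proof -
  interpret pair_graph "sunlet k n"
    using assms by (rule pair_graph_sunlet)
  show ?thesis
    by unfold_locales
qed

lemma graph_dist_le_iff:
  assumes "wf_digraph G"
  shows "graph_dist G u v \<le> ereal (real n) \<longleftrightarrow> (\<exists>p. pre_digraph.awalk G u p v \<and> length p \<le> n)"
proof -
  interpret wf_digraph G by fact
  have cost: "awalk_cost (\<lambda>_. 1) p = real (length p)" for p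
    by (induction p) auto
  show ?thesis
  proof
    assume "graph_dist G u v \<le> ereal (real n)"
    also have "\<dots> < ereal (real n + 1)" by simp
    finally have "graph_dist G u v < ereal (real n + 1)" .
    then show "\<exists>p. awalk u p v \<and> length p \<le> n"
      unfolding graph_dist_def \<mu>_def cost by (auto simp: INF_less_iff)
  next
    assume "\<exists>p. awalk u p v \<and> length p \<le> n"
    then obtain p where "awalk u p v" "length p \<le> n" by blast
    then show "graph_dist G u v \<le> ereal (real n)"
      unfolding graph_dist_def \<mu>_def cost by (auto intro: INF_lower2)
  qed
qed

lemma broadcast_number_attained:
  assumes "wf_digraph G"
  obtains f where "dominating_broadcast G f" "broadcast_cost G f = broadcast_number G"
proof -
  interpret wf_digraph G by fact
  have "graph_dist G u u \<le> ereal (real 1)" if "u \<in> verts G" for u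
    unfolding graph_dist_le_iff[OF assms]
    using that by (intro exI[of _ "[]"]) (simp add: awalk_Nil_iff)
  then have "dominating_broadcast G (\<lambda>_. 1)"
    unfolding dominating_broadcast_def by auto
  then have "\<exists>c f. dominating_broadcast G f \<and> broadcast_cost G f = c" by blast
  from LeastI_ex[OF this] show ?thesis
    using that unfolding broadcast_number_def by blast
qed

lemma broadcast_number_le:
  assumes "dominating_broadcast G f"
  shows "broadcast_number G \<le> broadcast_cost G f"
  unfolding broadcast_number_def using assms by (blast intro: Least_le)

end

theory Submission
  imports Defs
begin

text \<open>
  A broadcast of strength \<open>m + 1\<close> from a base vertex dominates.  For the lower bound, test
  domination on the \<open>3m\<close> non-base vertices together with one base vertex: a ball of radius
  \<open>r \<ge> 1\<close> contains at most \<open>3r\<close> of these \<open>3m + 1\<close> vertices, so the cost is at least \<open>m + 1/3\<close>.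
\<close>

text \<open>A closed form for the distance when the cycle is a triangle; for longer cycles only a
  lower bound, as crossing between legs counts as one step. The sum of truncated differences is the
  absolute difference.\<close>

definition leg_dist :: "nat \<times> nat \<Rightarrow> nat \<times> nat \<Rightarrow> nat" where
  "leg_dist u v =
     (if fst u = fst v then (snd u - snd v) + (snd v - snd u) else snd u + snd v + 1)"

lemma pverts_sunlet: "pverts (sunlet k m) = {..<k} \<times> {..m}"
  by (simp add: sunlet_def Let_def)

lemma parcs_sunlet_leg:
  assumes "i < k" "j < m"
  shows "((i, Suc j), (i, j)) \<in> parcs (sunlet k m)"
  using assms by (simp add: sunlet_def Let_def)

lemma parcs_sunlet3_base:
  assumes "i < 3" "i \<noteq> 0"
  shows "((i, 0), (0, 0)) \<in> parcs (sunlet 3 m)"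
proof -
  have "i = 1 \<or> i = 2" using assms by auto
  then show ?thesis by (auto simp: sunlet_def Let_def)
qed

lemma leg_dist_arc:
  assumes "(u, v) \<in> parcs (sunlet k m)"
  shows "leg_dist u w \<le> Suc (leg_dist v w)"
  using assms by (auto simp: sunlet_def Let_def leg_dist_def)

text \<open>Each arc of the walk lowers \<open>leg_dist\<close> to \<open>v\<close> by at most one,
  and it ends at zero.\<close>

lemma leg_dist_le_length:
  assumes "k \<ge> 3" "pre_digraph.awalk (with_proj (sunlet k m)) u p v"
  shows "leg_dist u v \<le> length p"
proof -
  interpret pair_graph "sunlet k m"
    using assms(1) by (rule pair_graph_sunlet)
  show ?thesis
    using assms(2)
  proof (induction p arbitrary: u)
    case Nil
    then show ?case by (simp add: awalk_Nil_iff leg_dist_def)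
  next
    case (Cons e p)
    then have "e \<in> parcs (sunlet k m)" "fst e = u" "awalk (snd e) p v"
      by (auto simp: awalk_Cons_iff)
    with Cons.IH[of "snd e"] leg_dist_arc[of u "snd e" k m v] show ?case
      by (cases e) auto
  qed
qed

text \<open>Descend the leg in \<open>j\<close> arcs; in a triangle one further arc at most leads
  from its base to \<open>(0, 0)\<close>.\<close>

lemma ex_awalk_sunlet3_base:
  assumes "i < 3" "j \<le> m"
  shows "\<exists>p. pre_digraph.awalk (with_proj (sunlet 3 m)) (i, j) p (0, 0) \<and> length p \<le> Suc j"
proof -
  interpret pair_graph "sunlet 3 m"
    by (rule pair_graph_sunlet) simp
  show ?thesis
    using assms(2)
  proof (induction j)
    case 0
    show ?case
    proof (cases "i = 0")
      case True
      then show ?thesis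
        by (intro exI[of _ "[]"]) (simp add: awalk_Nil_iff pverts_sunlet)
    next
      case False
      with assms(1) show ?thesis
        by (intro exI[of _ "[((i, 0), (0, 0))]"])
          (simp add: awalk_Cons_iff awalk_Nil_iff pverts_sunlet parcs_sunlet3_base)
    qed
  next
    case (Suc j)
    then obtain p where "awalk (i, j) p (0, 0)" "length p \<le> Suc j" by auto
    with Suc.prems assms(1) show ?case
      by (intro exI[of _ "((i, Suc j), (i, j)) # p"])
        (simp add: awalk_Cons_iff parcs_sunlet_leg)
  qed
qed

text \<open>With all three base vertices, a ball of radius 1 around one of them would hold 4
  vertices for \<open>m \<ge> 1\<close>, breaking the bound \<open>3 * r\<close>.\<close>

definition test_vertices :: "nat \<Rightarrow> (nat \<times> nat) set" where
  "test_vertices m = insert (0, 0) ({..<3} \<times> {1..m})"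

lemma card_test_vertices: "card (test_vertices m) = 3 * m + 1"
  by (simp add: test_vertices_def)

lemma card_test_vertices_ball_le:
  assumes "fst v < 3" "r \<ge> 1"
  shows "card {u \<in> test_vertices m. leg_dist u v \<le> r} \<le> 3 * r"
proof (cases v)
  case (Pair i j)
  show ?thesis
  proof (cases "r \<le> j")
    case True
    \<comment> \<open>Other legs are at distance at least \<open>j + 1 > r\<close>, so the ball
      stays on leg \<open>i\<close> and has at most \<open>2 * r + 1\<close> vertices, which is at
      most \<open>3 * r\<close> as \<open>r \<ge> 1\<close>.\<close>
    have "{u \<in> test_vertices m. leg_dist u v \<le> r} \<subseteq> {i} \<times> {j - r..j + r}"
      using True Pair by (auto simp: test_vertices_def leg_dist_def split: if_splits)
    then have "card {u \<in> test_vertices m. leg_dist u v \<le> r} \<le> card ({i} \<times> {j - r..j + r})"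
      by (rule card_mono[rotated]) simp
    also have "\<dots> \<le> 3 * r"
      using True assms(2) by (simp add: card_cartesian_product)
    finally show ?thesis .
  next
    case False
    \<comment> \<open>Reaching another base uses up \<open>j + 1\<close>, leaving
      \<open>r - j - 1\<close> on each of the two other legs. The total with \<open>(0, 0)\<close>
      is at most \<open>3 * r - j - 1\<close>.\<close>
    let ?S = "insert (0, 0) ({i} \<times> {1..j + r} \<union> ({..<3} - {i}) \<times> {1..r - j - 1})"
    have "{u \<in> test_vertices m. leg_dist u v \<le> r} \<subseteq> ?S"
      using False Pair by (auto simp: test_vertices_def leg_dist_def split: if_splits)
    then have "card {u \<in> test_vertices m. leg_dist u v \<le> r} \<le> card ?S"
      by (rule card_mono[rotated]) simp
    also have "card ?S \<le> Suc (card ({i} \<times> {1..j + r} \<union> ({..<3} - {i}) \<times> {1..r - j - 1}))"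
      by (rule card_insert_le_m1) simp_all
    also have "\<dots> \<le> Suc (card ({i} \<times> {1..j + r}) + card (({..<3} - {i}) \<times> {1..r - j - 1}))"
      by (rule Suc_le_mono[THEN iffD2]) (rule card_Un_le)
    also have "\<dots> = Suc ((j + r) + 2 * (r - j - 1))"
      using assms(1) Pair by (simp add: card_cartesian_product)
    also have "\<dots> \<le> 3 * r"
      using False by linarith
    finally show ?thesis .
  qed
qed

lemma dominating_broadcast_sunlet3_cost:
  assumes "dominating_broadcast (with_proj (sunlet 3 m)) f"
  shows "m + 1 \<le> broadcast_cost (with_proj (sunlet 3 m)) f"
proof -
  interpret pair_graph "sunlet 3 m"
    by (rule pair_graph_sunlet) simp
  let ?V = "pverts (sunlet 3 m)"
  \<comment> \<open>The condition \<open>f v \<ge> 1\<close> empties the ball at silent vertices,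
    which would otherwise contain \<open>v\<close> itself at cost 0.\<close>
  let ?ball = "\<lambda>v. {u \<in> test_vertices m. f v \<ge> 1 \<and> leg_dist u v \<le> f v}"
  have "test_vertices m \<subseteq> ?V"
    by (auto simp: test_vertices_def pverts_sunlet)
  have "test_vertices m \<subseteq> (\<Union>v\<in>?V. ?ball v)"
  proof
    fix u assume u: "u \<in> test_vertices m"
    with \<open>test_vertices m \<subseteq> ?V\<close> have "u \<in> verts (with_proj (sunlet 3 m))" by auto
    with assms obtain v where "v \<in> verts (with_proj (sunlet 3 m))" and v: "f v \<ge> 1"
      and "graph_dist (with_proj (sunlet 3 m)) u v \<le> ereal (real (f v))"
      unfolding dominating_broadcast_def by blast
    then obtain p where "v \<in> ?V" "awalk u p v" "length p \<le> f v"
      using graph_dist_le_iff[OF wf_digraph_axioms] by auto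
    with leg_dist_le_length[of 3 m u p v] have "leg_dist u v \<le> f v" by simp
    with u v \<open>v \<in> ?V\<close> show "u \<in> (\<Union>v\<in>?V. ?ball v)" by blast
  qed
  moreover have fin: "finite (test_vertices m)"
    by (simp add: test_vertices_def)
  ultimately have "card (test_vertices m) \<le> card (\<Union>v\<in>?V. ?ball v)"
    by (intro card_mono) auto
  also have "\<dots> \<le> (\<Sum>v\<in>?V. card (?ball v))"
    by (rule card_UN_le) simp
  also have "\<dots> \<le> (\<Sum>v\<in>?V. 3 * f v)"
  proof (rule sum_mono)
    fix v assume "v \<in> ?V"
    then have "fst v < 3" by (auto simp: pverts_sunlet)
    then show "card (?ball v) \<le> 3 * f v"
      using card_test_vertices_ball_le[of v "f v" m] by (cases "f v \<ge> 1") auto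
  qed
  also have "\<dots> = 3 * broadcast_cost (with_proj (sunlet 3 m)) f"
    by (simp add: broadcast_cost_def sum_distrib_left)
  \<comment> \<open>By integrality, \<open>3 * m + 1\<close> being at most three times the cost
    forces the cost up to \<open>m + 1\<close>.\<close>
  finally show ?thesis
    by (simp add: card_test_vertices)
qed

theorem theorem3:
  fixes m :: nat
  assumes "m \<ge> 1"
  shows "broadcast_number (with_proj (sunlet 3 m)) = m + 1"
proof (rule antisym)
  interpret pair_graph "sunlet 3 m"
    by (rule pair_graph_sunlet) simp
  let ?G = "with_proj (sunlet 3 m)"
  let ?f = "\<lambda>v::nat \<times> nat. if v = (0, 0) then m + 1 else 0"
  have base: "(0, 0) \<in> pverts (sunlet 3 m)"
    by (simp add: pverts_sunlet)
  have "graph_dist ?G u (0, 0) \<le> ereal (real (m + 1))" if u: "u \<in> pverts (sunlet 3 m)" for u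
  proof -
    obtain i j where "u = (i, j)" "i < 3" "j \<le> m"
      using u by (auto simp: pverts_sunlet)
    \<comment> \<open>The walk has length at most \<open>Suc j\<close>, and
      \<open>j \<le> m\<close>.\<close>
    with ex_awalk_sunlet3_base[of i j m] show ?thesis
      unfolding graph_dist_le_iff[OF wf_digraph_axioms] by fastforce
  qed
  with base have "dominating_broadcast ?G ?f"
    unfolding dominating_broadcast_def by (auto intro!: bexI[of _ "(0, 0)"])
  from broadcast_number_le[OF this] show "broadcast_number ?G \<le> m + 1"
    using base by (simp add: broadcast_cost_def)
  show "m + 1 \<le> broadcast_number ?G"
    using dominating_broadcast_sunlet3_cost broadcast_number_attained[OF wf_digraph_axioms]
    by metis
qed

end
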